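(* Let $F=\{F_{\varsigma}\}_{\varsigma\in\mathfrak{A}}$ be a continuous frame for $\mathcal{H}$. Then the following assertions hold: (1) If $G=\{G_{\varsigma}\}_{\varsigma\in\mathfrak{A}}$ is a dual frame of $F$ and $\{F_{\varsigma}\}_{\varsigma\in K}\cup\{G_{\varsigma}\}_{\varsigma\in K^{C}}$ is a continuous frame sequence for every $K\subset\mathfrak{A}$, then $F$ and $G$ are continuous woven. (2) If $F$ is a continuous Riesz basis for $\mathcal{H}$, then $F$ and its canonical dual $\{S_F^{-1}F_\varsigma\}_{\varsigma\in\mathfrak{A}}$ are continuous woven.
   Context: $\mathcal{H}$ is a separable Hilbert space and $(\mathfrak{A},\mu)$ a measure space with positive measure $\mu$. All families $\{F_\varsigma\}_{\varsigma\in\mathfrak{A}}\subset\mathcal{H}$ are such that $\varsigma\mapsto\langle f,F_\varsigma\rangle$ is measurable for each $f\in\mathcal{H}$; vector-valued integrals are understood weakly; subsets $K$ of $\mathfrak{A}$ are measurable; $K^C$ is the complement of $K$. A family $F=\{F_\varsigma\}_{\varsigma\in\mathfrak{A}}$ is a continuous frame for $\mathcal{H}$ if there are constants $0<A_F\le B_F<\infty$ with $A_F\|f\|^2\le\int_{\mathfrak{A}}|\langle f,F_\varsigma\rangle|^2d\mu(\varsigma)\le B_F\|f\|^2$ for all $f\in\mathcal{H}$. Its frame operator is $S_Ff=\int_{\mathfrak{A}}\langle f,F_\varsigma\rangle F_\varsigma\,d\mu(\varsigma)$, a bounded, invertible, self-adjoint operator. A family is a continuous frame sequence if it is a continuous frame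 for its closed linear span. For $\{F_\varsigma\}_{\varsigma\in K}\cup\{G_\varsigma\}_{\varsigma\in K^C}$ the frame expression is $\int_K|\langle f,F_\varsigma\rangle|^2d\mu(\varsigma)+\int_{K^C}|\langle f,G_\varsigma\rangle|^2d\mu(\varsigma)$. A continuous frame $\{G_\varsigma\}_{\varsigma\in\mathfrak{A}}$ is a dual frame of $F$ if $f=\int_{\mathfrak{A}}\langle f,G_\varsigma\rangle F_\varsigma\,d\mu(\varsigma)$ for all $f\in\mathcal{H}$. $F$ is a continuous Riesz basis if $\overline{\mathrm{span}}\{F_\varsigma\}_{\varsigma\in\mathfrak{A}}=\mathcal{H}$ and there are constants $0<A\le B<\infty$ with $A\int_{\mathfrak{A}}|\alpha_\varsigma|^2d\mu(\varsigma)\le\|\int_{\mathfrak{A}}\alpha_\varsigma F_\varsigma d\mu(\varsigma)\|^2\le B\int_{\mathfrak{A}}|\alpha_\varsigma|^2d\mu(\varsigma)$ for all $\{\alpha_\varsigma\}\in L^2(\mathfrak{A},\mu)$. Two families $\{F_\varsigma\}$ and $\{G_\varsigma\}$ are continuous woven if there are universal constants $0<A\le B<\infty$ such that for every $K\subset\mathfrak{A}$ the family $\{F_\varsigma\}_{\varsigma\in K}\cup\{G_\varsigma\}_{\varsigma\in K^C}$ is a continuous frame for $\mathcal{H}$ with bounds $A$ and $B$. *)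

theory Defs
  imports "HOL-Analysis.Analysis"
begin

class scaleC =
  fixes scaleC :: "complex \<Rightarrow> 'a \<Rightarrow> 'a"  (infixr "*\<^sub>C" 75)

text \<open>
  The norm and topology are those of the underlying real inner product space, whose
  inner product is the real part of the complex one; positive definiteness of
  \<open>cinner\<close> and \<open>norm x = sqrt (Re (cinner x x))\<close> follow.
  \<open>cinner\<close> is linear in its first argument.
\<close>

class complex_inner = real_inner + scaleC +
  fixes cinner :: "'a \<Rightarrow> 'a \<Rightarrow> complex"
  assumes scaleC_add_right: "a *\<^sub>C (x + y) = a *\<^sub>C x + a *\<^sub>C y"
    and scaleC_add_left: "(a + b) *\<^sub>C x = a *\<^sub>C x + b *\<^sub>C x"
    and scaleC_scaleC: "a *\<^sub>C b *\<^sub>C x = (a * b) *\<^sub>C x"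
    and scaleC_one: "1 *\<^sub>C x = x"
    and scaleR_scaleC: "r *\<^sub>R x = complex_of_real r *\<^sub>C x"
    and cinner_commute: "cinner x y = cnj (cinner y x)"
    and cinner_add_left: "cinner (x + y) z = cinner x z + cinner y z"
    and cinner_scaleC_left: "cinner (a *\<^sub>C x) y = a * cinner x y"
    and inner_eq_Re_cinner: "inner x y = Re (cinner x y)"

class complex_hilbert = complex_inner + complete_space

global_interpretation complex_vector:
    vector_space "scaleC :: complex \<Rightarrow> 'h \<Rightarrow> 'h :: complex_inner"
  defines cspan = "complex_vector.span"
  by standard (simp_all add: scaleC_add_right scaleC_add_left scaleC_scaleC scaleC_one)

instantiation complex :: complex_hilbert
begin

definition scaleC_complex :: "complex \<Rightarrow> complex \<Rightarrow> complex"
  where "scaleC_complex a x = a * x"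

definition cinner_complex :: "complex \<Rightarrow> complex \<Rightarrow> complex"
  where "cinner_complex x y = x * cnj y"

instance
  by standard
    (auto simp: scaleC_complex_def cinner_complex_def algebra_simps scaleR_conv_of_real
      inner_complex_def)

end

definition weakly_measurable_on ::
    "'h::complex_inner set \<Rightarrow> 'a measure \<Rightarrow> ('a \<Rightarrow> 'h) \<Rightarrow> bool"
  where "weakly_measurable_on V M F \<longleftrightarrow>
    (\<forall>f\<in>V. (\<lambda>s. cinner f (F s)) \<in> borel_measurable M)"

text \<open>
  Vector-valued integrals are weak: \<open>v\<close> is the integral of \<open>\<phi>\<close> if every scalar
  function \<open>cinner (\<phi> s) g\<close> is integrable with integral \<open>cinner v g\<close>. Such a \<open>v\<close> is unique.
\<close>

definition has_weak_integral ::
    "'a measure \<Rightarrow> ('a \<Rightarrow> 'h::complex_inner) \<Rightarrow> 'h \<Rightarrow> bool"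
  where "has_weak_integral M \<phi> v \<longleftrightarrow>
    (\<forall>g. integrable M (\<lambda>s. cinner (\<phi> s) g) \<and> (LINT s|M. cinner (\<phi> s) g) = cinner v g)"

definition weak_integral :: "'a measure \<Rightarrow> ('a \<Rightarrow> 'h::complex_inner) \<Rightarrow> 'h"
  where "weak_integral M \<phi> = (THE v. has_weak_integral M \<phi> v)"

definition closed_linear_span :: "'a measure \<Rightarrow> ('a \<Rightarrow> 'h::complex_inner) \<Rightarrow> 'h set"
  where "closed_linear_span M F = closure (cspan (F ` space M))"

text \<open>
  Frames are relative to a closed subspace \<open>V\<close>, regarded as a Hilbert space of its own.
  The integral is a nonnegative one with values in \<open>ennreal\<close>, so that the upper
  bound includes finiteness.
\<close>

definition continuous_frame_bounds_on ::
    "'h::complex_inner set \<Rightarrow> 'a measure \<Rightarrow> ('a \<Rightarrow> 'h) \<Rightarrow> real \<Rightarrow> real \<Rightarrow> bool"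
  where "continuous_frame_bounds_on V M F A B \<longleftrightarrow>
    0 < A \<and> A \<le> B \<and> F ` space M \<subseteq> V \<and> weakly_measurable_on V M F \<and>
    (\<forall>f\<in>V. ennreal (A * (norm f)\<^sup>2) \<le> (\<integral>\<^sup>+ s. ennreal ((cmod (cinner f (F s)))\<^sup>2) \<partial>M) \<and>
           (\<integral>\<^sup>+ s. ennreal ((cmod (cinner f (F s)))\<^sup>2) \<partial>M) \<le> ennreal (B * (norm f)\<^sup>2))"

definition continuous_frame_on ::
    "'h::complex_inner set \<Rightarrow> 'a measure \<Rightarrow> ('a \<Rightarrow> 'h) \<Rightarrow> bool"
  where "continuous_frame_on V M F \<longleftrightarrow> (\<exists>A B. continuous_frame_bounds_on V M F A B)"

abbreviation continuous_frame :: "'a measure \<Rightarrow> ('a \<Rightarrow> 'h::complex_inner) \<Rightarrow> bool"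
  where "continuous_frame \<equiv> continuous_frame_on UNIV"

definition continuous_frame_sequence :: "'a measure \<Rightarrow> ('a \<Rightarrow> 'h::complex_inner) \<Rightarrow> bool"
  where "continuous_frame_sequence M F \<longleftrightarrow> continuous_frame_on (closed_linear_span M F) M F"

definition frame_operator :: "'a measure \<Rightarrow> ('a \<Rightarrow> 'h::complex_inner) \<Rightarrow> 'h \<Rightarrow> 'h"
  where "frame_operator M F f = weak_integral M (\<lambda>s. cinner f (F s) *\<^sub>C F s)"

text \<open>
  For a continuous frame of a Hilbert space the frame operator is a bijection of the whole space.
\<close>

definition canonical_dual :: "'a measure \<Rightarrow> ('a \<Rightarrow> 'h::complex_inner) \<Rightarrow> 'a \<Rightarrow> 'h"
  where "canonical_dual M F s = inv (frame_operator M F) (F s)"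

definition dual_frame ::
    "'a measure \<Rightarrow> ('a \<Rightarrow> 'h::complex_inner) \<Rightarrow> ('a \<Rightarrow> 'h) \<Rightarrow> bool"
  where "dual_frame M F G \<longleftrightarrow> continuous_frame M G \<and>
    (\<forall>f. has_weak_integral M (\<lambda>s. cinner f (G s) *\<^sub>C F s) f)"

definition L2_functions :: "'a measure \<Rightarrow> ('a \<Rightarrow> complex) set"
  where "L2_functions M =
    {\<alpha> \<in> borel_measurable M. integrable M (\<lambda>s. (cmod (\<alpha> s))\<^sup>2)}"

definition continuous_Riesz_basis :: "'a measure \<Rightarrow> ('a \<Rightarrow> 'h::complex_inner) \<Rightarrow> bool"
  where "continuous_Riesz_basis M F \<longleftrightarrow>
    weakly_measurable_on UNIV M F \<and> closed_linear_span M F = UNIV \<and>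
    (\<exists>A B. 0 < A \<and> A \<le> B \<and>
      (\<forall>\<alpha>\<in>L2_functions M. \<exists>v. has_weak_integral M (\<lambda>s. \<alpha> s *\<^sub>C F s) v \<and>
        A * (LINT s|M. (cmod (\<alpha> s))\<^sup>2) \<le> (norm v)\<^sup>2 \<and>
        (norm v)\<^sup>2 \<le> B * (LINT s|M. (cmod (\<alpha> s))\<^sup>2)))"

definition weaving :: "'a set \<Rightarrow> ('a \<Rightarrow> 'h) \<Rightarrow> ('a \<Rightarrow> 'h) \<Rightarrow> 'a \<Rightarrow> 'h"
  where "weaving K F G s = (if s \<in> K then F s else G s)"

text \<open>
  The integral used in \<^const>\<open>continuous_frame_bounds_on\<close> is the usual frame expression
  of a weaving.
\<close>

lemma weaving_frame_expression:
  fixes F G :: "'a \<Rightarrow> 'h::complex_inner"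
  assumes "weakly_measurable_on UNIV M F" "weakly_measurable_on UNIV M G" "K \<in> sets M"
  shows "(\<integral>\<^sup>+ s. ennreal ((cmod (cinner f (weaving K F G s)))\<^sup>2) \<partial>M) =
    (\<integral>\<^sup>+ s\<in>K. ennreal ((cmod (cinner f (F s)))\<^sup>2) \<partial>M) +
    (\<integral>\<^sup>+ s\<in>space M - K. ennreal ((cmod (cinner f (G s)))\<^sup>2) \<partial>M)"
proof -
  have [measurable]: "(\<lambda>s. cinner f (F s)) \<in> borel_measurable M"
      "(\<lambda>s. cinner f (G s)) \<in> borel_measurable M" "K \<in> sets M"
    using assms by (auto simp: weakly_measurable_on_def)
  have "(\<integral>\<^sup>+ s. ennreal ((cmod (cinner f (weaving K F G s)))\<^sup>2) \<partial>M) =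
    (\<integral>\<^sup>+ s. ennreal ((cmod (cinner f (F s)))\<^sup>2) * indicator K s +
      ennreal ((cmod (cinner f (G s)))\<^sup>2) * indicator (space M - K) s \<partial>M)"
    by (rule nn_integral_cong) (auto simp: weaving_def indicator_def)
  then show ?thesis
    by (simp add: nn_integral_add)
qed

definition continuous_woven ::
    "'a measure \<Rightarrow> ('a \<Rightarrow> 'h::complex_inner) \<Rightarrow> ('a \<Rightarrow> 'h) \<Rightarrow> bool"
  where "continuous_woven M F G \<longleftrightarrow>
    (\<exists>A B. 0 < A \<and> A \<le> B \<and>
      (\<forall>K\<in>sets M. continuous_frame_bounds_on UNIV M (weaving K F G) A B))"

end

theory Submission
  imports Defs
begin

text \<open>
  If \<open>G\<close> is a dual frame of \<open>F\<close>, then \<open>\<parallel>f\<parallel>\<^sup>2 = \<integral> \<langle>f, G\<^sub>s\<rangle> \<langle>F\<^sub>s, f\<rangle>\<close>. Fix a measurable set \<open>K\<close>.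
  At each \<open>s\<close> one of the two factors belongs to the weaving \<open>W\<close> that uses \<open>F\<close> on \<open>K\<close> and
  \<open>G\<close> elsewhere, and the other to the weaving \<open>W'\<close> that uses \<open>G\<close> on \<open>K\<close> and \<open>F\<close> elsewhere. The
  frame expression of \<open>W'\<close> is at most \<open>C \<parallel>f\<parallel>\<^sup>2\<close>, where \<open>C\<close> is the sum of the upper frame bounds of
  \<open>F\<close> and \<open>G\<close>. The Cauchy--Schwarz inequality then gives \<open>\<parallel>f\<parallel>\<^sup>2 \<le> C \<integral> \<bar>\<langle>f, W\<^sub>s\<rangle>\<bar>\<^sup>2\<close>. Thus every
  weaving has the bounds \<open>1 / C\<close> and \<open>C\<close>, and these are the same for all \<open>K\<close>. This is
  \<open>dual_frames_woven\<close>; the inequality behind it is \<open>energy_absorption\<close>.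

  The second assertion reduces to the first, because the canonical dual of a Riesz basis is a
  dual frame (\<open>canonical_dual_is_dual_frame\<close>). The frame operator exists because a Riesz basis
  can synthesize every \<open>L\<^sup>2\<close> function, in particular the coefficients
  of a vector. The frame bounds make it bounded and coercive, hence bijective
  (\<open>coercive_bounded_bij\<close>), and it is self-adjoint, which moves its inverse from the dual family to
  the vector.
\<close>

section \<open>The complex inner product and weak integrals\<close>

lemma cinner_self: "cinner x x = of_real ((norm x)\<^sup>2)"
proof -
  have "Im (cinner x x) = 0"
    using arg_cong[OF cinner_commute[of x x], of Im] by simp
  then show ?thesis
    by (simp add: complex_eq_iff inner_eq_Re_cinner[symmetric] power2_norm_eq_inner)
qed

lemma cmod_cinner_commute: "cmod (cinner x y) = cmod (cinner y x)"
  by (subst cinner_commute) simp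

lemma cinner_diff_left: "cinner (x - y) z = cinner x z - cinner y z"
  using cinner_add_left[of "x - y" y z] by simp

lemma cinner_eqI:
  assumes "\<And>g. cinner v g = cinner w g"
  shows "v = w"
  using assms[of "v - w"] cinner_self[of "v - w"] by (simp add: cinner_diff_left)

lemma weak_integral_eqI:
  assumes "has_weak_integral M \<phi> v"
  shows "weak_integral M \<phi> = v"
  unfolding weak_integral_def
proof (rule the_equality)
  show "has_weak_integral M \<phi> v"
    by (fact assms)
  fix w assume "has_weak_integral M \<phi> w"
  with assms have "cinner w g = cinner v g" for g
    by (simp add: has_weak_integral_def)
  then show "w = v"
    by (rule cinner_eqI)
qed

lemma has_weak_integral_scaleC_cinner:
  assumes "has_weak_integral M (\<lambda>s. \<alpha> s *\<^sub>C F s) v"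
  shows "integrable M (\<lambda>s. \<alpha> s * cinner (F s) g)"
    and "(LINT s|M. \<alpha> s * cinner (F s) g) = cinner v g"
  using assms by (simp_all add: has_weak_integral_def cinner_scaleC_left)

section \<open>Absorbing one factor of an energy estimate\<close>

text \<open>
  The pairing is bounded by the weighted inequality
  \<open>2 \<bar>a b\<bar> \<le> B a\<^sup>2 + b\<^sup>2 / B\<close> instead of by the Cauchy--Schwarz inequality. The weight is chosen
  such that the second term contributes at most \<open>x / 2\<close>, which the left-hand side absorbs.
  With \<open>x\<close> a squared norm represented by an integral, this yields the lower bound of a
  weaving, and also the boundedness of the frame operator.
\<close>

lemma energy_absorption:
  fixes p :: "'a \<Rightarrow> complex" and a b :: "'a \<Rightarrow> real"
  assumes "integrable M p" and x: "(LINT s|M. p s) = of_real x" "0 \<le> x"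
    and p: "\<And>s. cmod (p s) \<le> a s * b s"
    and [measurable]: "a \<in> borel_measurable M" "b \<in> borel_measurable M"
    and b: "(\<integral>\<^sup>+ s. ennreal ((b s)\<^sup>2) \<partial>M) \<le> ennreal (B * x)" and B: "0 < B"
  shows "ennreal x \<le> ennreal B * (\<integral>\<^sup>+ s. ennreal ((a s)\<^sup>2) \<partial>M)"
proof (cases "(\<integral>\<^sup>+ s. ennreal ((a s)\<^sup>2) \<partial>M) = \<infinity>")
  case True
  then show ?thesis
    using B by (simp add: ennreal_mult_top)
next
  case False
  have ia: "integrable M (\<lambda>s. (a s)\<^sup>2)" and ib: "integrable M (\<lambda>s. (b s)\<^sup>2)"
    using False b by (auto intro!: integrableI_nonneg simp: less_top le_less_trans)
  have b': "(LINT s|M. (b s)\<^sup>2) \<le> B * x"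
    using b B x by (subst (asm) nn_integral_eq_integral[OF ib]) auto
  have young: "a s * b s \<le> (B / 2) * (a s)\<^sup>2 + (1 / (2 * B)) * (b s)\<^sup>2" for s
  proof -
    have "0 \<le> (B * a s - b s)\<^sup>2 / (2 * B)"
      using B by simp
    also have "\<dots> = (B / 2) * (a s)\<^sup>2 + (1 / (2 * B)) * (b s)\<^sup>2 - a s * b s"
      using B by (simp add: field_simps power2_eq_square)
    finally show ?thesis by simp
  qed
  have "x = cmod (LINT s|M. p s)"
    using x by simp
  also have "\<dots> \<le> (LINT s|M. cmod (p s))"
    by (rule integral_norm_bound)
  also have "\<dots> \<le> (LINT s|M. (B / 2) * (a s)\<^sup>2 + (1 / (2 * B)) * (b s)\<^sup>2)"
    using assms(1) ia ib order_trans[OF p young] by (intro integral_mono) auto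
  also have "\<dots> = (B / 2) * (LINT s|M. (a s)\<^sup>2) + (1 / (2 * B)) * (LINT s|M. (b s)\<^sup>2)"
    using ia ib by simp
  also have "\<dots> \<le> (B / 2) * (LINT s|M. (a s)\<^sup>2) + (1 / (2 * B)) * (B * x)"
    using b' B by (intro add_left_mono mult_left_mono) auto
  also have "\<dots> = (B / 2) * (LINT s|M. (a s)\<^sup>2) + x / 2"
    using B by simp
  finally have "x \<le> B * (LINT s|M. (a s)\<^sup>2)"
    by simp
  then show ?thesis
    using B by (subst nn_integral_eq_integral[OF ia])
      (auto simp: ennreal_mult[symmetric] intro!: ennreal_leI)
qed

section \<open>A frame and a dual frame are woven\<close>

lemma continuous_frame_bounds_onD:
  assumes "continuous_frame_bounds_on UNIV M F A B"
  shows "0 < A" "0 < B" "weakly_measurable_on UNIV M F"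
    "(\<lambda>s. cinner f (F s)) \<in> borel_measurable M"
    "ennreal (A * (norm f)\<^sup>2) \<le> (\<integral>\<^sup>+ s. ennreal ((cmod (cinner f (F s)))\<^sup>2) \<partial>M)"
    "(\<integral>\<^sup>+ s. ennreal ((cmod (cinner f (F s)))\<^sup>2) \<partial>M) \<le> ennreal (B * (norm f)\<^sup>2)"
  using assms unfolding continuous_frame_bounds_on_def weakly_measurable_on_def by auto

lemma weaving_measurable:
  assumes "weakly_measurable_on UNIV M F" "weakly_measurable_on UNIV M G" and K: "K \<in> sets M"
  shows "(\<lambda>s. cinner f (weaving K F G s)) \<in> borel_measurable M"
proof -
  have [measurable]: "(\<lambda>s. cinner f (F s)) \<in> borel_measurable M"
      "(\<lambda>s. cinner f (G s)) \<in> borel_measurable M"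
    using assms by (auto simp: weakly_measurable_on_def)
  have "(\<lambda>s. if s \<in> K then cinner f (F s) else cinner f (G s)) \<in> borel_measurable M"
    using K by measurable
  then show ?thesis
    by (simp add: weaving_def if_distrib[of "cinner f"])
qed

lemma weaving_upper_bound:
  assumes F: "continuous_frame_bounds_on UNIV M F A B"
    and G: "continuous_frame_bounds_on UNIV M G A' B'"
  shows "(\<integral>\<^sup>+ s. ennreal ((cmod (cinner f (weaving K F G s)))\<^sup>2) \<partial>M)
    \<le> ennreal ((B + B') * (norm f)\<^sup>2)"
proof -
  note [measurable] = continuous_frame_bounds_onD(4)[OF F] continuous_frame_bounds_onD(4)[OF G]
  have "(\<integral>\<^sup>+ s. ennreal ((cmod (cinner f (weaving K F G s)))\<^sup>2) \<partial>M)
    \<le> (\<integral>\<^sup>+ s. ennreal ((cmod (cinner f (F s)))\<^sup>2) + ennreal ((cmod (cinner f (G s)))\<^sup>2) \<partial>M)"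
    by (intro nn_integral_mono) (auto simp: weaving_def)
  also have "\<dots> = (\<integral>\<^sup>+ s. ennreal ((cmod (cinner f (F s)))\<^sup>2) \<partial>M) +
      (\<integral>\<^sup>+ s. ennreal ((cmod (cinner f (G s)))\<^sup>2) \<partial>M)"
    by (simp add: nn_integral_add)
  also have "\<dots> \<le> ennreal (B * (norm f)\<^sup>2) + ennreal (B' * (norm f)\<^sup>2)"
    by (intro add_mono continuous_frame_bounds_onD(6)[OF F] continuous_frame_bounds_onD(6)[OF G])
  also have "\<dots> = ennreal ((B + B') * (norm f)\<^sup>2)"
    using continuous_frame_bounds_onD(2)[OF F] continuous_frame_bounds_onD(2)[OF G]
    by (simp add: ennreal_plus[symmetric] algebra_simps del: ennreal_plus)
  finally show ?thesis .
qed

text \<open>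
  The integrand of \<open>\<parallel>f\<parallel>\<^sup>2 = \<integral> \<langle>f, G\<^sub>s\<rangle> \<langle>F\<^sub>s, f\<rangle>\<close> contains, at each \<open>s\<close>, one coefficient of the weaving
  over \<open>K\<close> and one of the opposite weaving, in which the roles of \<open>F\<close> and \<open>G\<close> are exchanged.
  The upper bound \<open>B + B'\<close> of the opposite weaving does not depend on \<open>K\<close>, so neither does
  the lower bound \<open>1 / (B + B')\<close> that \<open>energy_absorption\<close> yields.
\<close>

lemma dual_frames_woven:
  fixes F :: "'a \<Rightarrow> 'h::complex_inner"
  assumes "continuous_frame M F" and dual: "dual_frame M F G"
  shows "continuous_woven M F G"
proof -
  obtain A B A' B' where F: "continuous_frame_bounds_on UNIV M F A B"
    and G: "continuous_frame_bounds_on UNIV M G A' B'"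
    using assms unfolding dual_frame_def continuous_frame_on_def by blast
  note measF = continuous_frame_bounds_onD(3)[OF F]
    and measG = continuous_frame_bounds_onD(3)[OF G]
  define C where "C = B + B'"
  have C: "0 < C"
    using continuous_frame_bounds_onD(2)[OF F] continuous_frame_bounds_onD(2)[OF G]
    by (simp add: C_def)
  have upper: "(\<integral>\<^sup>+ s. ennreal ((cmod (cinner f (weaving K F G s)))\<^sup>2) \<partial>M)
      \<le> ennreal (C * (norm f)\<^sup>2)"
    and upper': "(\<integral>\<^sup>+ s. ennreal ((cmod (cinner f (weaving K G F s)))\<^sup>2) \<partial>M)
      \<le> ennreal (C * (norm f)\<^sup>2)" for f K
    using weaving_upper_bound[OF F G] weaving_upper_bound[OF G F]
    by (simp_all add: C_def add.commute)
  have lower: "ennreal (1 / C * (norm f)\<^sup>2)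
      \<le> (\<integral>\<^sup>+ s. ennreal ((cmod (cinner f (weaving K F G s)))\<^sup>2) \<partial>M)"
    if K: "K \<in> sets M" for f K
  proof -
    have "has_weak_integral M (\<lambda>s. cinner f (G s) *\<^sub>C F s) f"
      using dual by (simp add: dual_frame_def)
    note repr = has_weak_integral_scaleC_cinner[OF this, of f]
    have "ennreal ((norm f)\<^sup>2)
      \<le> ennreal C * (\<integral>\<^sup>+ s. ennreal ((cmod (cinner f (weaving K F G s)))\<^sup>2) \<partial>M)"
    proof (rule energy_absorption[OF repr(1)])
      show "cmod (cinner f (G s) * cinner (F s) f)
          \<le> cmod (cinner f (weaving K F G s)) * cmod (cinner f (weaving K G F s))" for s
        by (simp add: weaving_def norm_mult cmod_cinner_commute[of "F s"])
    qed (use weaving_measurable[OF measF measG K] weaving_measurable[OF measG measF K]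
          upper' C repr(2) in \<open>auto simp: cinner_self\<close>)
    then have "ennreal (1 / C) * ennreal ((norm f)\<^sup>2)
      \<le> ennreal (1 / C) *
        (ennreal C * (\<integral>\<^sup>+ s. ennreal ((cmod (cinner f (weaving K F G s)))\<^sup>2) \<partial>M))"
      by (rule mult_left_mono) simp
    also have "\<dots> = (\<integral>\<^sup>+ s. ennreal ((cmod (cinner f (weaving K F G s)))\<^sup>2) \<partial>M)"
      using C by (simp add: mult.assoc[symmetric] ennreal_mult[symmetric])
    finally show ?thesis
      using C by (simp add: ennreal_mult[symmetric])
  qed
  show ?thesis
    unfolding continuous_woven_def
  proof (intro exI conjI ballI)
    show "0 < 1 / C"
      using C by simp
    (* C can be less than 1 if the space is trivial; the maximum keeps the bounds in order. *)
    show "1 / C \<le> max C (1 / C)"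
      by simp
    fix K assume K: "K \<in> sets M"
    show "continuous_frame_bounds_on UNIV M (weaving K F G) (1 / C) (max C (1 / C))"
      unfolding continuous_frame_bounds_on_def weakly_measurable_on_def
    proof (intro conjI ballI)
      show "0 < 1 / C" "1 / C \<le> max C (1 / C)"
        using C by simp_all
      fix f :: 'h
      show "(\<lambda>s. cinner f (weaving K F G s)) \<in> borel_measurable M"
        by (rule weaving_measurable[OF measF measG K])
      show "ennreal (1 / C * (norm f)\<^sup>2)
          \<le> (\<integral>\<^sup>+ s. ennreal ((cmod (cinner f (weaving K F G s)))\<^sup>2) \<partial>M)"
        by (rule lower[OF K])
      show "(\<integral>\<^sup>+ s. ennreal ((cmod (cinner f (weaving K F G s)))\<^sup>2) \<partial>M)
          \<le> ennreal (max C (1 / C) * (norm f)\<^sup>2)"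
        by (intro order_trans[OF upper ennreal_leI] mult_right_mono) auto
    qed auto
  qed
qed

section \<open>The canonical dual is a dual frame\<close>

text \<open>
  The theorem of Lax and Milgram: for a small step \<open>t\<close> the map \<open>x \<mapsto> x - t (S x - y)\<close> is a
  contraction, because
  \<open>\<parallel>z - t S z\<parallel>\<^sup>2 \<le> (1 - 2 t A + t\<^sup>2 B\<^sup>2) \<parallel>z\<parallel>\<^sup>2\<close>; its fixed points are the preimages of \<open>y\<close>.
\<close>

lemma coercive_bounded_bij:
  fixes S :: "'h::{real_inner, complete_space} \<Rightarrow> 'h"
  assumes diff: "\<And>x y. S (x - y) = S x - S y"
    and coercive: "\<And>x. A * (norm x)\<^sup>2 \<le> S x \<bullet> x" and A: "0 < A"
    and bounded: "\<And>x. norm (S x) \<le> B * norm x" and AB: "A \<le> B"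
  shows "bij S"
proof -
  define t where "t = A / B\<^sup>2"
  define c where "c = sqrt (1 - A\<^sup>2 / B\<^sup>2)"
  have t: "0 < t" and c1: "0 \<le> 1 - A\<^sup>2 / B\<^sup>2" "c < 1"
    using A AB by (auto simp: t_def c_def power_mono)
  have c: "0 \<le> c" "c\<^sup>2 = 1 - A\<^sup>2 / B\<^sup>2"
    using c1 by (auto simp: c_def)
  have contr: "norm (z - t *\<^sub>R S z) \<le> c * norm z" for z
  proof (rule power2_le_imp_le)
    have "(norm (z - t *\<^sub>R S z))\<^sup>2 = (norm z)\<^sup>2 - 2 * t * (S z \<bullet> z) + t\<^sup>2 * (norm (S z))\<^sup>2"
      unfolding power2_norm_eq_inner
      by (simp add: inner_diff_left inner_diff_right inner_commute power2_eq_square algebra_simps)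
    also have "\<dots> \<le> (norm z)\<^sup>2 - 2 * t * (A * (norm z)\<^sup>2) + t\<^sup>2 * (B * norm z)\<^sup>2"
      using t coercive[of z] bounded[of z]
      by (intro add_mono diff_mono mult_left_mono power_mono) auto
    also have "\<dots> = (1 - A\<^sup>2 / B\<^sup>2) * (norm z)\<^sup>2"
      using A AB by (simp add: t_def field_simps power2_eq_square)
    finally show "(norm (z - t *\<^sub>R S z))\<^sup>2 \<le> (c * norm z)\<^sup>2"
      by (simp add: power_mult_distrib c)
  qed (use c in simp)
  have "\<exists>!x. S x = y" for y
  proof -
    have "dist (u - t *\<^sub>R (S u - y)) (v - t *\<^sub>R (S v - y)) \<le> c * dist u v" for u v
      using contr[of "u - v"] by (simp add: dist_norm diff algebra_simps)
    then have "\<exists>!x. x - t *\<^sub>R (S x - y) = x"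
      using c(1) c1(2) by (intro banach_fix_type) auto
    then show ?thesis
      using t by simp
  qed
  then show ?thesis
    by (simp add: bij_iff)
qed

text \<open>
  Boundedness is once more an absorption: \<open>\<parallel>S f\<parallel>\<^sup>2\<close> is the integral of
  \<open>\<langle>f, F\<^sub>s\<rangle> \<langle>F\<^sub>s, S f\<rangle>\<close>, and the second factor has energy at most \<open>B \<parallel>S f\<parallel>\<^sup>2\<close>.
  Coercivity is the lower frame bound, since \<open>\<langle>S f, f\<rangle>\<close> is the frame expression of \<open>f\<close>.
\<close>

lemma frame_operator_properties:
  fixes F :: "'a \<Rightarrow> 'h::complex_hilbert"
  assumes F: "continuous_frame_bounds_on UNIV M F A B"
    and S: "\<And>f. has_weak_integral M (\<lambda>s. cinner f (F s) *\<^sub>C F s) (S f)"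
  shows frame_operator_self_adjoint: "cinner (S f) g = cinner f (S g)"
    and frame_operator_bounded: "norm (S f) \<le> B * norm f"
    and frame_operator_coercive: "A * (norm f)\<^sup>2 \<le> S f \<bullet> f"
    and frame_operator_bij: "bij S"
proof -
  note S' = has_weak_integral_scaleC_cinner[OF S]
  note FD = continuous_frame_bounds_onD[OF F]
  have sa: "cinner (S f) g = cinner f (S g)" for f g
  proof -
    have "cinner f (S g) = cnj (LINT s|M. cinner g (F s) * cinner (F s) f)"
      by (subst cinner_commute) (simp add: S'(2))
    also have "\<dots> = (LINT s|M. cinner f (F s) * cinner (F s) g)"
      unfolding Bochner_Integration.integral_cnj[symmetric]
      by (intro Bochner_Integration.integral_cong refl)
        (metis complex_cnj_mult cinner_commute mult.commute)
    finally show ?thesis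
      by (simp add: S'(2))
  qed
  have bounded: "norm (S f) \<le> B * norm f" for f
  proof -
    have "ennreal ((norm (S f))\<^sup>2)
      \<le> ennreal B * (\<integral>\<^sup>+ s. ennreal ((cmod (cinner f (F s)))\<^sup>2) \<partial>M)"
    proof (rule energy_absorption[OF S'(1)])
      show "cmod (cinner f (F s) * cinner (F s) (S f))
        \<le> cmod (cinner f (F s)) * cmod (cinner (S f) (F s))" for s
        by (simp add: norm_mult cmod_cinner_commute[of "F s"])
    qed (use FD S'(2) in \<open>auto simp: cinner_self\<close>)
    also have "\<dots> \<le> ennreal B * ennreal (B * (norm f)\<^sup>2)"
      by (intro mult_left_mono FD) simp
    also have "\<dots> = ennreal ((B * norm f)\<^sup>2)"
      using FD(2) by (simp add: ennreal_mult[symmetric] power2_eq_square algebra_simps)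
    finally show ?thesis
      using FD(2) by (intro power2_le_imp_le[of "norm (S f)"]) (auto simp: ennreal_le_iff)
  qed
  have coercive: "A * (norm f)\<^sup>2 \<le> S f \<bullet> f" for f
  proof -
    have "cinner f (F s) * cinner (F s) f = of_real ((cmod (cinner f (F s)))\<^sup>2)" for s
      by (subst cinner_commute[of "F s"]) (simp only: complex_norm_square)
    then have *: "integrable M (\<lambda>s. complex_of_real ((cmod (cinner f (F s)))\<^sup>2))"
      "(LINT s|M. complex_of_real ((cmod (cinner f (F s)))\<^sup>2)) = cinner (S f) f"
      using S'(1)[of f f] S'(2)[of f f] by simp_all
    then have int: "integrable M (\<lambda>s. (cmod (cinner f (F s)))\<^sup>2)"
      by (metis complex_of_real_integrable_eq)
    have eq: "(LINT s|M. (cmod (cinner f (F s)))\<^sup>2) = S f \<bullet> f"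
      using *(2) unfolding integral_complex_of_real inner_eq_Re_cinner
      by (metis Re_complex_of_real)
    show ?thesis
      using FD(5)[of f] nn_integral_eq_integral[OF int] eq
      by (metis (no_types, lifting) AE_I2 ennreal_le_iff integral_nonneg_AE zero_le_power2)
  qed
  have diff: "S (x - y) = S x - S y" for x y
    by (rule cinner_eqI) (simp add: sa cinner_diff_left)
  have "A \<le> B"
    using F by (simp add: continuous_frame_bounds_on_def)
  then show "bij S"
    using FD(1) by (intro coercive_bounded_bij[OF diff coercive _ bounded])
  show "cinner (S f) g = cinner f (S g)" "norm (S f) \<le> B * norm f" "A * (norm f)\<^sup>2 \<le> S f \<bullet> f"
    by (fact sa bounded coercive)+
qed

text \<open>
  By self-adjointness the coefficients of \<open>f\<close> in \<open>{S\<^sup>-\<^sup>1 F\<^sub>s}\<close> are those of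
  \<open>S\<^sup>-\<^sup>1 f\<close> in \<open>{F\<^sub>s}\<close>. Hence they synthesize \<open>S (S\<^sup>-\<^sup>1 f) = f\<close>, and the frame bounds follow
  from \<open>\<parallel>f\<parallel> / B \<le> \<parallel>S\<^sup>-\<^sup>1 f\<parallel> \<le> \<parallel>f\<parallel> / A\<close>.
\<close>

lemma canonical_dual_is_dual_frame:
  fixes F :: "'a \<Rightarrow> 'h::complex_hilbert"
  assumes "continuous_frame M F"
    and ex: "\<And>f. \<exists>v. has_weak_integral M (\<lambda>s. cinner f (F s) *\<^sub>C F s) v"
  shows "dual_frame M F (canonical_dual M F)"
proof -
  obtain A B where F: "continuous_frame_bounds_on UNIV M F A B"
    using assms(1) by (auto simp: continuous_frame_on_def)
  note FD = continuous_frame_bounds_onD[OF F]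
  define S where "S = frame_operator M F"
  define R where "R = inv S"
  have S: "has_weak_integral M (\<lambda>s. cinner f (F s) *\<^sub>C F s) (S f)" for f
    using ex[of f] by (auto simp: S_def frame_operator_def dest: weak_integral_eqI)
  note Sprops = frame_operator_properties[where S = S, OF F S]
  have SR: "S (R f) = f" for f
    unfolding R_def by (rule surj_f_inv_f[OF bij_is_surj[OF Sprops(4)]])
  have coeff: "cinner f (canonical_dual M F s) = cinner (R f) (F s)" for f s
  proof -
    have "canonical_dual M F s = R (F s)"
      by (simp add: canonical_dual_def R_def S_def)
    then show ?thesis
      using Sprops(1)[of "R f" "R (F s)"] by (simp add: SR)
  qed
  have R_upper: "norm (R f) \<le> norm f / A" for f
  proof (cases "R f = 0")
    case False
    have "A * (norm (R f))\<^sup>2 \<le> norm f * norm (R f)"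
      using Sprops(3)[of "R f"] norm_cauchy_schwarz[of f "R f"] by (simp add: SR)
    with False FD(1) show ?thesis
      by (simp add: power2_eq_square field_simps)
  qed (use FD(1) in simp)
  have R_lower: "norm f / B \<le> norm (R f)" for f
    using Sprops(2)[of "R f"] FD(2) by (simp add: SR field_simps)
  have "A \<le> B"
    using F by (simp add: continuous_frame_bounds_on_def)
  have "continuous_frame_bounds_on UNIV M (canonical_dual M F) (A / B\<^sup>2) (B / A\<^sup>2)"
    unfolding continuous_frame_bounds_on_def weakly_measurable_on_def coeff
  proof (intro conjI ballI)
    show "0 < A / B\<^sup>2"
      using FD(1,2) by simp
    show "A / B\<^sup>2 \<le> B / A\<^sup>2"
      using FD(1,2) \<open>A \<le> B\<close> by (intro frac_le power_mono) auto
    fix f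
    show "(\<lambda>s. cinner (R f) (F s)) \<in> borel_measurable M"
      by (rule FD)
    have "A / B\<^sup>2 * (norm f)\<^sup>2 = A * (norm f / B)\<^sup>2"
      by (simp add: power_divide)
    also have "\<dots> \<le> A * (norm (R f))\<^sup>2"
      using FD(1,2) R_lower by (intro mult_left_mono power_mono) auto
    finally show "ennreal (A / B\<^sup>2 * (norm f)\<^sup>2)
        \<le> (\<integral>\<^sup>+ s. ennreal ((cmod (cinner (R f) (F s)))\<^sup>2) \<partial>M)"
      by (rule order_trans[OF ennreal_leI FD(5)])
    have "B * (norm (R f))\<^sup>2 \<le> B * (norm f / A)\<^sup>2"
      using FD(1,2) R_upper by (intro mult_left_mono power_mono) auto
    also have "\<dots> = B / A\<^sup>2 * (norm f)\<^sup>2"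
      by (simp add: power_divide)
    finally show "(\<integral>\<^sup>+ s. ennreal ((cmod (cinner (R f) (F s)))\<^sup>2) \<partial>M)
        \<le> ennreal (B / A\<^sup>2 * (norm f)\<^sup>2)"
      by (rule order_trans[OF FD(6) ennreal_leI])
  qed auto
  moreover have "has_weak_integral M (\<lambda>s. cinner f (canonical_dual M F s) *\<^sub>C F s) f" for f
    using S[of "R f"] by (simp only: coeff SR)
  ultimately show ?thesis
    unfolding dual_frame_def continuous_frame_on_def by blast
qed

text \<open>
  The coefficients of a vector lie in \<open>L\<^sup>2\<close> by the upper frame bound, and a Riesz basis can
  synthesize every \<open>L\<^sup>2\<close> function.
\<close>

lemma Riesz_basis_frame_operator_exists:
  assumes "continuous_frame M F" "continuous_Riesz_basis M F"
  shows "\<exists>v. has_weak_integral M (\<lambda>s. cinner f (F s) *\<^sub>C F s) v"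
proof -
  obtain A B where F: "continuous_frame_bounds_on UNIV M F A B"
    using assms(1) by (auto simp: continuous_frame_on_def)
  note FD = continuous_frame_bounds_onD[OF F]
  note [measurable] = FD(4)
  have "integrable M (\<lambda>s. (cmod (cinner f (F s)))\<^sup>2)"
    using FD(6)[of f] by (intro integrableI_nonneg) (auto simp: le_less_trans)
  then have "(\<lambda>s. cinner f (F s)) \<in> L2_functions M"
    by (simp add: L2_functions_def FD(4))
  then show ?thesis
    using assms(2) unfolding continuous_Riesz_basis_def by (elim conjE exE) (drule (1) bspec, blast)
qed

theorem theorem3p3:
  fixes M :: "'a measure" and F :: "'a \<Rightarrow> 'h::complex_hilbert"
  assumes separable: "separable_space (euclidean :: 'h topology)"
    and frame: "continuous_frame M F"
  shows "(\<forall>G. dual_frame M F G \<and>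
            (\<forall>K\<in>sets M. continuous_frame_sequence M (weaving K F G)) \<longrightarrow>
            continuous_woven M F G) \<and>
         (continuous_Riesz_basis M F \<longrightarrow> continuous_woven M F (canonical_dual M F))"
proof (intro conjI allI impI)
  show "continuous_woven M F G"
    if "dual_frame M F G \<and> (\<forall>K\<in>sets M. continuous_frame_sequence M (weaving K F G))" for G
    using that by (intro dual_frames_woven[OF frame]) simp
  show "continuous_woven M F (canonical_dual M F)" if "continuous_Riesz_basis M F"
    by (intro dual_frames_woven[OF frame] canonical_dual_is_dual_frame[OF frame]
      Riesz_basis_frame_operator_exists[OF frame that])
qed

end
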